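(* Let $\mathcal{B}$ be a countable basis for the standard topology of $\mathbb{R}^n$ and let $\nu$ be a coding for $\mathcal{B}$. Then there does not exist a partial recursive function $\phi$ (taking a set of non-negative integers as an oracle argument and a non-negative integer $m$ as input) such that for every singleton set $\{x\}\subseteq\mathbb{R}^n$ and every basic representation $R_x$ of $\{x\}$ in the effective topology $(\mathcal{B},\nu)$, the function $m\mapsto\phi(R_x,m)$ is an oracle for $x$ in $(\mathcal{B},\nu)$.
   Context: A coding $\nu$ of a countable basis $\mathcal{B}$ is a (not necessarily injective) assignment $n\mapsto\nu(n)$ of basis elements to non-negative integers under which every basis element is coded; $\mathrm{dom}_{\mathcal{B}}\nu$ is the set of $n$ with $\nu(n)\in\mathcal{B}$. The pair $(\mathcal{B},\nu)$ is then an effective topology. A set $\mathcal{L}_x\subseteq\mathcal{B}$ is a local basis for $x$ iff every member contains $x$ and every $B\in\mathcal{B}$ containing $x$ has a subset in $\mathcal{L}_x$. With $\mathbb{N}$ the non-negative integers, a function $\psi:\mathbb{N}\to\mathrm{dom}_{\mathcal{B}}\nu$ is an oracle for $x$ iff $\{\nu(\psi(n)):n\in\mathbb{N}\}$ is a local basis for $x$. A set $R$ of non-negative integers is a basic representation of $A\subseteq\mathbb{R}^n$ iff $R\subseteq\mathrm{dom}_{\mathcal{B}}\nu$ and, for all $y\in\mathbb{R}^n$, $y\in A$ iff some local basis $\mathcal{L}_y$ for $y$ satisfies $\mathcal{L}_y\subseteq\{\nu(r):r\in R\}$. The function $\phi(R,m)$ is partial recursive in the sense of being computed by an oracle Turing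 machine with oracle the set $R$ (membership queries) and input $m$. *)

theory Defs
  imports "HOL-Analysis.Analysis"
begin

text \<open>
  \<open>\<nu>\<close> is a total HOL function. A code that is assigned no basis element is modelled by giving it
  an arbitrary value outside \<open>\<B>\<close>, which exists because \<open>\<B>\<close> is countable; this is why
  \<open>range \<nu> \<subseteq> \<B>\<close> is not required.
\<close>

definition coding :: "'a set set \<Rightarrow> (nat \<Rightarrow> 'a set) \<Rightarrow> bool" where
  "coding \<B> \<nu> \<longleftrightarrow> \<B> \<subseteq> range \<nu>"

definition coding_dom :: "'a set set \<Rightarrow> (nat \<Rightarrow> 'a set) \<Rightarrow> nat set" where
  "coding_dom \<B> \<nu> = {n. \<nu> n \<in> \<B>}"

definition local_basis :: "'a set set \<Rightarrow> 'a \<Rightarrow> 'a set set \<Rightarrow> bool" where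
  "local_basis \<B> x \<L> \<longleftrightarrow>
     \<L> \<subseteq> \<B> \<and> (\<forall>U\<in>\<L>. x \<in> U) \<and> (\<forall>B\<in>\<B>. x \<in> B \<longrightarrow> (\<exists>U\<in>\<L>. U \<subseteq> B))"

definition is_oracle_for ::
  "'a set set \<Rightarrow> (nat \<Rightarrow> 'a set) \<Rightarrow> 'a \<Rightarrow> (nat \<Rightarrow> nat) \<Rightarrow> bool" where
  "is_oracle_for \<B> \<nu> x \<psi> \<longleftrightarrow>
     range \<psi> \<subseteq> coding_dom \<B> \<nu> \<and> local_basis \<B> x {\<nu> (\<psi> n) |n. True}"

definition basic_representation ::
  "'a set set \<Rightarrow> (nat \<Rightarrow> 'a set) \<Rightarrow> nat set \<Rightarrow> 'a set \<Rightarrow> bool" where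
  "basic_representation \<B> \<nu> R A \<longleftrightarrow>
     R \<subseteq> coding_dom \<B> \<nu> \<and>
     (\<forall>y. y \<in> A \<longleftrightarrow> (\<exists>\<L>. local_basis \<B> y \<L> \<and> \<L> \<subseteq> {\<nu> r |r. r \<in> R}))"

text \<open>
  Oracle Turing machines, in the quadruple form of M. Davis, \<^emph>\<open>Computability and Unsolvability\<close>
  (1958). States and tape symbols are natural numbers, symbol \<open>0\<close> is the blank, and the tape is
  infinite in both directions. A program maps a state and a scanned symbol to an instruction, and
  the machine halts where no instruction applies. Finiteness of the program's domain makes the
  state set and the alphabet effectively finite. The last component of an instruction is the next
  state; \<open>Query q q'\<close> continues in \<open>q\<close> or \<open>q'\<close> according to whether the number of \<open>1\<close>s
  currently on the tape belongs to the oracle set. The other symbols carry all remaining data, so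
  any number can be queried without losing information.
\<close>

datatype instr = Write nat nat | MoveLeft nat | MoveRight nat | Query nat nat

type_synonym program = "nat \<times> nat \<Rightarrow> instr option"

text \<open>State, tape contents, head position.\<close>

type_synonym config = "nat \<times> (int \<Rightarrow> nat) \<times> int"

definition ones :: "(int \<Rightarrow> nat) \<Rightarrow> nat" where
  "ones t = card {i. t i = 1}"

fun step :: "program \<Rightarrow> nat set \<Rightarrow> config \<Rightarrow> config option" where
  "step P A (q, t, p) =
     (case P (q, t p) of
        None \<Rightarrow> None
      | Some (Write s q') \<Rightarrow> Some (q', t(p := s), p)
      | Some (MoveLeft q') \<Rightarrow> Some (q', t, p - 1)
      | Some (MoveRight q') \<Rightarrow> Some (q', t, p + 1)
      | Some (Query q' q'') \<Rightarrow> Some (if ones t \<in> A then q' else q'', t, p))"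

text \<open>The input \<open>m\<close> is written as \<open>m + 1\<close> strokes, with the head on the leftmost one.\<close>

definition initial_config :: "nat \<Rightarrow> config" where
  "initial_config m = (0, (\<lambda>i. if 0 \<le> i \<and> i \<le> int m then 1 else 0), 0)"

definition outputs :: "program \<Rightarrow> nat set \<Rightarrow> nat \<Rightarrow> nat \<Rightarrow> bool" where
  "outputs P A m k \<longleftrightarrow>
     (\<exists>q t p. (\<lambda>c c'. step P A c = Some c')\<^sup>*\<^sup>* (initial_config m) (q, t, p) \<and>
        step P A (q, t, p) = None \<and> ones t = k)"

lemma outputs_unique:
  assumes "outputs P A m k" and "outputs P A m k'"
  shows "k = k'"
proof -
  let ?R = "\<lambda>c c'. step P A c = Some c'"
  have halt_unique: "d = d'"
    if "?R\<^sup>*\<^sup>* c d" "step P A d = None" "?R\<^sup>*\<^sup>* c d'" "step P A d' = None" for c d d'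
    using that
  proof (induction rule: converse_rtranclp_induct)
    case base
    then show ?case by (auto elim: converse_rtranclpE)
  next
    case (step y z)
    from step.prems(2) show ?case
      by (rule converse_rtranclpE) (use step in auto)
  qed
  show ?thesis using assms halt_unique unfolding outputs_def by blast
qed

text \<open>
  A partial function of an oracle set and a number, with \<open>None\<close> for divergence, is partial
  recursive if a single program, not depending on the oracle set, computes it.
\<close>

definition partial_recursive :: "(nat set \<Rightarrow> nat \<Rightarrow> nat option) \<Rightarrow> bool" where
  "partial_recursive \<phi> \<longleftrightarrow>
     (\<exists>P. finite (dom P) \<and> (\<forall>A m k. \<phi> A m = Some k \<longleftrightarrow> outputs P A m k))"

end

theory Submission
  imports Defs
begin

text \<open>
  A halting computation queries only finitely many numbers, and every singleton \<open>{y}\<close> has a basic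
  representation with prescribed answers to finitely many queries, as long as the numbers required
  to belong to it are codes of basis elements: finitely many extra sets never create a local basis,
  because the space has no isolated points. So if \<open>R\<^sub>x\<close> is a basic representation of \<open>{x}\<close>, then
  every \<open>{y}\<close> has a basic representation \<open>R\<^sub>y\<close> with \<open>\<phi>(R\<^sub>y, m) = \<phi>(R\<^sub>x, m)\<close>. This is absurd if \<open>y\<close>
  lies outside \<open>\<nu>(\<phi>(R\<^sub>x, m))\<close>, and some \<open>m\<close> makes this set different from the whole space.
\<close>

text \<open>Each configuration of a run consults the oracle about at most one number, so collecting
  these numbers along the finite run, by induction on its length, gives \<open>Q\<close>.\<close>

lemma outputs_finite_use:
  assumes "outputs P A m k"
  shows "\<exists>Q. finite Q \<and> (\<forall>A'. A' \<inter> Q = A \<inter> Q \<longrightarrow> outputs P A' m k)"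
proof -
  let ?R = "\<lambda>A c c'. step P A c = Some c'"
  \<comment> \<open>Only a \<open>Query\<close> instruction looks at the oracle set, and the one
    number it asks about is \<open>ones t\<close>.\<close>
  have step_use: "step P A' (q, t, p) = step P A (q, t, p)"
    if "A' \<inter> {ones t} = A \<inter> {ones t}" for A' q t p
  proof -
    have "ones t \<in> A' \<longleftrightarrow> ones t \<in> A"
      using that by blast
    then show ?thesis
      by (auto split: option.split instr.split)
  qed
  have run_use: "\<exists>Q. finite Q \<and> (\<forall>A'. A' \<inter> Q = A \<inter> Q \<longrightarrow> (?R A')\<^sup>*\<^sup>* c d)"
    if "(?R A)\<^sup>*\<^sup>* c d" for c d
    using that
  proof (induction rule: rtranclp_induct)
    case base
    then show ?case by blast
  next
    case (step d e)
    obtain q t p where d: "d = (q, t, p)"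
      by (cases d)
    from step.IH obtain Q where Q: "finite Q"
      "\<And>A'. A' \<inter> Q = A \<inter> Q \<Longrightarrow> (?R A')\<^sup>*\<^sup>* c d"
      by blast
    have "(?R A')\<^sup>*\<^sup>* c e" if A': "A' \<inter> insert (ones t) Q = A \<inter> insert (ones t) Q" for A'
    proof (rule rtranclp.rtrancl_into_rtrancl)
      show "(?R A')\<^sup>*\<^sup>* c d"
        using A' by (intro Q) blast
      have "A' \<inter> {ones t} = A \<inter> {ones t}"
        using A' by blast
      then show "Defs.step P A' d = Some e"
        using step.hyps(2) step_use unfolding d by metis
    qed
    with Q(1) show ?case
      by (intro exI[of _ "insert (ones t) Q"]) blast
  qed
  from assms obtain q t p where run: "(?R A)\<^sup>*\<^sup>* (initial_config m) (q, t, p)"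
    and halt: "step P A (q, t, p) = None" and k: "ones t = k"
    unfolding outputs_def by blast
  from run_use[OF run] obtain Q where Q: "finite Q"
    "\<And>A'. A' \<inter> Q = A \<inter> Q \<Longrightarrow> (?R A')\<^sup>*\<^sup>* (initial_config m) (q, t, p)"
    by blast
  \<comment> \<open>\<open>ones t\<close> of the final configuration joins \<open>Q\<close> so that
    \<open>step_use\<close> transfers halting as well.\<close>
  show ?thesis
  proof (intro exI[of _ "insert (ones t) Q"] conjI allI impI)
    show "finite (insert (ones t) Q)"
      using Q(1) by simp
    fix A' assume A': "A' \<inter> insert (ones t) Q = A \<inter> insert (ones t) Q"
    have "(?R A')\<^sup>*\<^sup>* (initial_config m) (q, t, p)"
      using A' by (intro Q) blast
    moreover have "A' \<inter> {ones t} = A \<inter> {ones t}"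
      using A' by blast
    then have "step P A' (q, t, p) = None"
      using halt step_use by metis
    ultimately show "outputs P A' m k"
      using k unfolding outputs_def by blast
  qed
qed

text \<open>If \<open>\<L>\<close> were finite, its intersection would be an open set around
  \<open>z\<close> and so contain a second point \<open>w\<close>. A basis element around
  \<open>z\<close> that omits \<open>w\<close> then has no subset in \<open>\<L>\<close>.\<close>

lemma local_basis_infinite:
  fixes z :: "'a :: {t1_space, perfect_space}"
  assumes basis: "topological_basis \<B>" and lb: "local_basis \<B> z \<L>"
  shows "infinite \<L>"
proof
  assume fin: "finite \<L>"
  have sub: "\<L> \<subseteq> \<B>" and mem: "\<And>U. U \<in> \<L> \<Longrightarrow> z \<in> U"
    and small: "\<And>B. B \<in> \<B> \<Longrightarrow> z \<in> B \<Longrightarrow> \<exists>U\<in>\<L>. U \<subseteq> B"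
    using lb unfolding local_basis_def by auto
  have op: "open (\<Inter>\<L>)"
    using fin sub basis by (intro open_Inter) (auto intro: topological_basis_open)
  obtain w where w: "w \<in> \<Inter>\<L>" "w \<noteq> z"
  proof -
    have "\<Inter>\<L> \<noteq> {z}"
      using op not_open_singleton by metis
    moreover have "z \<in> \<Inter>\<L>"
      using mem by blast
    ultimately show thesis
      using that by blast
  qed
  obtain B where "B \<in> \<B>" "z \<in> B" "B \<subseteq> - {w}"
    using topological_basisE[OF basis, of "- {w}" z] w(2) by auto
  then show False
    using small w(1) by blast
qed

text \<open>\<open>F\<close> and \<open>N\<close> hold the prescribed positive and negative oracle
  answers. \<open>R\<close> consists of \<open>F\<close> and codes outside \<open>N\<close> of
  neighbourhoods shrinking to \<open>y\<close>.\<close>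

lemma basic_representation_singleton_exists:
  fixes y :: "'a :: {metric_space, perfect_space}"
  assumes basis: "topological_basis \<B>" and cod: "coding \<B> \<nu>"
    and F: "finite F" "F \<subseteq> coding_dom \<B> \<nu>"
    and N: "finite N" "F \<inter> N = {}"
  obtains R where "basic_representation \<B> \<nu> R {y}" and "F \<subseteq> R" and "R \<inter> N = {}"
proof -
  have ex: "\<exists>c. c \<notin> N \<and> \<nu> c \<in> \<B> \<and> y \<in> \<nu> c \<and> \<nu> c \<subseteq> ball y (inverse (real (Suc k)))" for k
  proof -
    \<comment> \<open>Every set coded in \<open>M\<close> contains all of \<open>V\<close>, hence
      also \<open>w\<close>. A basis element around \<open>y\<close> inside \<open>V - {w}\<close>
      therefore differs from all of them, so none of its codes lies in \<open>N\<close>, even if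
      \<open>\<nu>\<close> is not injective.\<close>
    define M where "M = {n \<in> N. \<nu> n \<in> \<B> \<and> y \<in> \<nu> n}"
    define V where "V = (\<Inter>n\<in>M. \<nu> n) \<inter> ball y (inverse (real (Suc k)))"
    have "open V"
      unfolding V_def M_def using N(1) basis
      by (intro open_Int open_INT) (auto intro: topological_basis_open)
    moreover have yV: "y \<in> V"
      unfolding V_def M_def by simp
    moreover have "V \<noteq> {y}"
      using \<open>open V\<close> not_open_singleton by metis
    ultimately obtain w where w: "w \<in> V" "w \<noteq> y"
      by blast
    have "open (V - {w})"
      using \<open>open V\<close> by auto
    then obtain B where B: "B \<in> \<B>" "y \<in> B" "B \<subseteq> V - {w}"
      using topological_basisE[OF basis, of "V - {w}" y] yV w(2) by auto
    obtain c where c: "B = \<nu> c"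
      using cod B(1) unfolding coding_def by blast
    have "c \<notin> N"
    proof
      assume "c \<in> N"
      then have "c \<in> M"
        using B c unfolding M_def by simp
      then show False
        using B(3) w(1) c unfolding V_def by blast
    qed
    then show ?thesis
      using B c unfolding V_def by blast
  qed
  then obtain c where c: "\<And>k. c k \<notin> N" "\<And>k. \<nu> (c k) \<in> \<B>" "\<And>k. y \<in> \<nu> (c k)"
    "\<And>k. \<nu> (c k) \<subseteq> ball y (inverse (real (Suc k)))"
    by metis
  define R where "R = F \<union> range c"
  have R_dom: "R \<subseteq> coding_dom \<B> \<nu>"
    using F(2) c(2) unfolding R_def coding_dom_def by auto
  have lb: "local_basis \<B> y (\<nu> ` range c)"
    unfolding local_basis_def
  proof (intro conjI ballI impI)
    show "\<nu> ` range c \<subseteq> \<B>"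
      using c(2) by auto
    show "y \<in> U" if "U \<in> \<nu> ` range c" for U
      using that c(3) by auto
    fix B assume "B \<in> \<B>" "y \<in> B"
    then obtain e where e: "e > 0" "ball y e \<subseteq> B"
      using topological_basis_open[OF basis] open_contains_ball by metis
    obtain k where "inverse (real (Suc k)) < e"
      using reals_Archimedean e(1) by blast
    then have "\<nu> (c k) \<subseteq> B"
      using c(4)[of k] e(2) by (meson order.trans less_imp_le subset_ball)
    then show "\<exists>U\<in>\<nu> ` range c. U \<subseteq> B"
      by blast
  qed
  have uniq: "z = y" if z: "local_basis \<B> z \<L>" "\<L> \<subseteq> \<nu> ` R" for z \<L>
  proof (rule ccontr)
    assume "z \<noteq> y"
    then obtain k where k: "inverse (real (Suc k)) < dist y z"
      using reals_Archimedean[of "dist y z"] by auto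
    \<comment> \<open>For \<open>j > k\<close> the set \<open>\<nu> (c j)\<close> lies in a ball
      around \<open>y\<close> too small to reach \<open>z\<close>, so only finitely many sets remain
      for \<open>\<L>\<close>.\<close>
    have "\<L> \<subseteq> \<nu> ` (F \<union> c ` {..k})"
    proof
      fix U assume U: "U \<in> \<L>"
      then have "z \<in> U"
        using z(1) unfolding local_basis_def by blast
      obtain r where r: "U = \<nu> r" "r \<in> F \<union> range c"
        using U z(2) unfolding R_def by blast
      have "j \<le> k" if "r = c j" for j
      proof (rule ccontr)
        assume "\<not> j \<le> k"
        then have "inverse (real (Suc j)) \<le> inverse (real (Suc k))"
          by (simp add: le_imp_inverse_le)
        moreover have "dist y z < inverse (real (Suc j))"
          using c(4)[of j] \<open>z \<in> U\<close> r(1) that by auto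
        ultimately show False
          using k by linarith
      qed
      then show "U \<in> \<nu> ` (F \<union> c ` {..k})"
        using r by auto
    qed
    then have "finite \<L>"
      by (rule finite_subset) (use F(1) in auto)
    then show False
      using local_basis_infinite[OF basis z(1)] by blast
  qed
  show thesis
  proof (rule that)
    have "\<nu> ` range c \<subseteq> \<nu> ` R"
      unfolding R_def by blast
    then have "z \<in> {y} \<longleftrightarrow> (\<exists>\<L>. local_basis \<B> z \<L> \<and> \<L> \<subseteq> \<nu> ` R)" for z
      using lb uniq by blast
    then show "basic_representation \<B> \<nu> R {y}"
      unfolding basic_representation_def Setcompr_eq_image using R_dom by simp
    show "F \<subseteq> R"
      unfolding R_def by blast
    show "R \<inter> N = {}"
      using N(2) c(1) unfolding R_def by auto
  qed
qed

theorem theorem11: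
  fixes \<B> :: "(real ^ 'n) set set"
    and \<nu> :: "nat \<Rightarrow> (real ^ 'n) set"
  assumes "countable \<B>"
    and "topological_basis \<B>"
    and "coding \<B> \<nu>"
  shows "\<not> (\<exists>\<phi> :: nat set \<Rightarrow> nat \<Rightarrow> nat option.
              partial_recursive \<phi> \<and>
              (\<forall>x R. basic_representation \<B> \<nu> R {x} \<longrightarrow>
                 (\<exists>\<psi>. (\<forall>m. \<phi> R m = Some (\<psi> m)) \<and> is_oracle_for \<B> \<nu> x \<psi>)))"
proof
  assume "\<exists>\<phi> :: nat set \<Rightarrow> nat \<Rightarrow> nat option.
              partial_recursive \<phi> \<and>
              (\<forall>x R. basic_representation \<B> \<nu> R {x} \<longrightarrow>
                 (\<exists>\<psi>. (\<forall>m. \<phi> R m = Some (\<psi> m)) \<and> is_oracle_for \<B> \<nu> x \<psi>))"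
  then obtain \<phi> :: "nat set \<Rightarrow> nat \<Rightarrow> nat option" where "partial_recursive \<phi>"
    and solves: "\<And>x R. basic_representation \<B> \<nu> R {x} \<Longrightarrow>
      \<exists>\<psi>. (\<forall>m. \<phi> R m = Some (\<psi> m)) \<and> is_oracle_for \<B> \<nu> x \<psi>"
    by blast
  then obtain P where P: "\<And>A m k. \<phi> A m = Some k \<longleftrightarrow> outputs P A m k"
    unfolding partial_recursive_def by blast
  define x :: "real ^ 'n" where "x = 0"
  obtain R where R: "basic_representation \<B> \<nu> R {x}"
    using basic_representation_singleton_exists[OF assms(2,3), of "{}" "{}"] by auto
  then obtain \<psi> where \<psi>: "\<And>m. \<phi> R m = Some (\<psi> m)" "is_oracle_for \<B> \<nu> x \<psi>"
    using solves by blast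
  \<comment> \<open>A second point \<open>z\<close> is fixed first. Since \<open>\<psi>\<close>
    enumerates a local basis for \<open>x\<close>, some output \<open>\<psi> m\<close> codes a set
    that misses \<open>z\<close>.\<close>
  have "{x} \<noteq> UNIV"
    using not_open_singleton[of x] by force
  then obtain z where "z \<noteq> x"
    by blast
  then obtain B where B: "B \<in> \<B>" "x \<in> B" "B \<subseteq> - {z}"
    using topological_basisE[OF assms(2), of "- {z}" x] by auto
  have "\<exists>U\<in>{\<nu> (\<psi> m) |m. True}. U \<subseteq> B"
    using \<psi>(2) B(1,2) unfolding is_oracle_for_def local_basis_def by simp
  then obtain m where "\<nu> (\<psi> m) \<subseteq> B"
    by blast
  then have z: "z \<notin> \<nu> (\<psi> m)"
    using B(3) by blast
  have "outputs P R m (\<psi> m)"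
    using \<psi>(1) P by simp
  then obtain Q where Q: "finite Q" "\<And>A'. A' \<inter> Q = R \<inter> Q \<Longrightarrow> outputs P A' m (\<psi> m)"
    using outputs_finite_use by metis
  have "R \<inter> Q \<subseteq> coding_dom \<B> \<nu>"
    using R unfolding basic_representation_def by blast
  \<comment> \<open>Numbers in \<open>Q\<close> answered yes under \<open>R\<close> are forced into
    \<open>R'\<close>, those answered no are kept out, so the run on \<open>m\<close> cannot tell
    \<open>R'\<close> from \<open>R\<close>.\<close>
  then obtain R' where R': "basic_representation \<B> \<nu> R' {z}" "R \<inter> Q \<subseteq> R'" "R' \<inter> (Q - R) = {}"
    using basic_representation_singleton_exists[OF assms(2,3), of "R \<inter> Q" "Q - R" z] Q(1)
    by auto
  have "R' \<inter> Q = R \<inter> Q"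
    using R'(2,3) by blast
  then have "\<phi> R' m = Some (\<psi> m)"
    unfolding P by (rule Q(2))
  moreover obtain \<psi>' where "\<phi> R' m = Some (\<psi>' m)" "is_oracle_for \<B> \<nu> z \<psi>'"
    using solves R'(1) by blast
  moreover from this(2) have "z \<in> \<nu> (\<psi>' m)"
    unfolding is_oracle_for_def local_basis_def by auto
  ultimately show False
    using z by simp
qed

end
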